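(* Let $t \in [1,2)$ and $p > 2/(2-t)$. Then there exists a $t$-Frostman Borel measure $\mu$ on $[0,1]^{2}$ such that $\pi_{\theta}\mu \notin L^{p}(\mathbb{R})$ for every $\theta \in S^{1}$.
   Context: A Borel measure $\mu$ on $\mathbb{R}^{d}$ is called $t$-Frostman if there exists a constant $C > 0$ such that $\mu(B(x,r)) \leq C r^{t}$ for all $x \in \mathbb{R}^{d}$ and $r > 0$. A measure on $[0,1]^2$ is viewed as a measure on $\mathbb{R}^2$ supported in $[0,1]^2$. For $\theta \in S^{1}$ (the unit circle in $\mathbb{R}^2$), $\pi_{\theta}$ denotes the orthogonal projection of $\mathbb{R}^{2}$ onto the line $\mathrm{span}(\theta^{\perp})$ perpendicular to $\theta$; this line is identified with $\mathbb{R}$ isometrically, e.g. $\pi_\theta(x) = x \cdot \theta^{\perp}$ where $\theta^\perp$ is a unit vector orthogonal to $\theta$. $\pi_{\theta}\mu$ is the push-forward of $\mu$ under $\pi_{\theta}$, a Borel measure on $\mathbb{R}$. The statement $\pi_\theta \mu \in L^p(\mathbb{R})$ means that $\pi_\theta\mu$ is absolutely continuous with respect to Lebesgue measure with density in $L^p(\mathbb{R})$; $\pi_\theta\mu \notin L^p(\mathbb{R})$ is the negation of this. *)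

theory Defs
  imports "HOL-Analysis.Analysis"
begin

text \<open>The constant is uniform in the centre and the radius. Open and closed balls give the
  same notion, with the same constant.\<close>

definition frostman :: "real \<Rightarrow> 'a::euclidean_space measure \<Rightarrow> bool" where
  "frostman t \<mu> \<longleftrightarrow>
     (\<exists>C>0. \<forall>x. \<forall>r>0. emeasure \<mu> (ball x r) \<le> ennreal (C * r powr t))"

definition perp :: "real^2 \<Rightarrow> real^2" where
  "perp \<theta> = vector [- (\<theta> $ 2), \<theta> $ 1]"

text \<open>Orthogonal projection onto the line spanned by \<open>perp \<theta>\<close>, in the isometric coordinate
  \<open>s \<mapsto> s *\<^sub>R perp \<theta>\<close> of that line (\<open>\<theta>\<close> is a unit vector).\<close>

definition proj :: "real^2 \<Rightarrow> real^2 \<Rightarrow> real" where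
  "proj \<theta> x = x \<bullet> perp \<theta>"

definition proj_measure :: "real^2 \<Rightarrow> (real^2) measure \<Rightarrow> real measure" where
  "proj_measure \<theta> \<mu> = distr \<mu> borel (proj \<theta>)"

text \<open>A Borel measure on the line is identified with its Lebesgue density: it lies in
  \<open>L\<^sup>p\<close> if it is absolutely continuous with a density in \<open>L\<^sup>p\<close>. Such a density is finite almost
  everywhere, so a real-valued one can be chosen.\<close>

definition in_Lp :: "real \<Rightarrow> real measure \<Rightarrow> bool" where
  "in_Lp p \<nu> \<longleftrightarrow>
     (\<exists>f :: real \<Rightarrow> real. f \<in> borel_measurable borel \<and> (\<forall>x. 0 \<le> f x) \<and>
        \<nu> = density lborel (\<lambda>x. ennreal (f x)) \<and>
        integrable lborel (\<lambda>x. \<bar>f x\<bar> powr p))"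

end

theory Submission
  imports Defs
begin

text \<open>If \<open>\<nu>\<close> has a density in \<open>L\<^sup>p\<close>, then every interval of length \<open>L\<close> has
\<open>\<nu>\<close>-measure \<open>O(L powr (1 - 1/p))\<close> (\<open>in_Lp_interval_bound\<close>). The condition
\<open>p > 2 / (2 - t)\<close> says exactly that \<open>1 - 1/p > t/2\<close>. So it is enough to build a
\<open>t\<close>-Frostman measure which, for every direction and for a sequence of widths \<open>d\<close>
tending to \<open>0\<close>, gives mass about \<open>d powr (t/2)\<close> to some tube of width comparable to
\<open>d\<close> in that direction; a loss that is small against the surplus \<open>d powr (t/2 - 1 + 1/p)\<close> is
harmless.

One scale works as follows. Cut the unit square into \<open>J\<close> horizontal strips of height
\<open>r = 1/J\<close>, and in each strip draw \<open>M\<close> needles, parallelograms that cross the strip and have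
horizontal width \<open>d = r\<^sup>2/M\<close>. A needle of height \<open>r\<close> lies in a tube of width \<open>O(d)\<close> for
all directions within \<open>d/r\<close> of its own, so the \<open>J * M\<close> needles can serve all slopes between \<open>-1\<close>
and \<open>1\<close> at once if their slopes form an arithmetic progression of step about
\<open>1/(J * M) = d/r\<close> (\<open>needle_density_heavy_tube\<close>). The measure is spread evenly over the needles,
each of which gets mass about \<open>1/(J * M)\<close>.

For the Frostman condition it suffices that every horizontal slice is \<open>(t - 1)\<close>-Frostman on the
line, with a uniform constant (\<open>square_integral_le_of_slices\<close>). A slice consists of \<open>M\<close> intervals
of length \<open>d\<close> and mass equal to the gap \<open>h = 1/(4 * M)\<close> between them; slopes increase from left to
right inside a strip and positions are measured from its bottom line, so the left ends never get closer
than \<open>h\<close>. Such a comb is \<open>(t - 1)\<close>-Frostman as soon as \<open>h \<le> d powr (t - 1)\<close>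
(\<open>comb_frostman\<close>). The choice \<open>M \<approx> J powr b\<close> with \<open>b = (2 * t - 2) / (2 - t)\<close> balances this
inequality and gives \<open>d \<approx> J powr (- 2 / (2 - t))\<close>, so that the mass of a needle is about
\<open>J powr (- t / (2 - t)) \<approx> d powr (t/2)\<close>, as wanted.

The final measure adds up such densities and their reflections in the diagonal, which serve the
directions closer to the horizontal, over a sequence of scales with weights \<open>2 ^ (- k)\<close>. The
Frostman constants are uniform, so the sum is \<open>t\<close>-Frostman, and if the scales go to \<open>0\<close> fast
enough the weights do not spoil the heavy tubes (\<open>not_in_Lp_needle_measure\<close>).\<close>

section \<open>Interval estimates for measures with an integrable power\<close>

text \<open>Pointwise \<open>f \<le> h + h powr (1 - p) * f powr p\<close> for every threshold \<open>h > 0\<close>, according to whether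
\<open>f \<le> h\<close> or not. Integrating over the interval and choosing \<open>h\<close> to balance the two terms gives
the exponent of Hoelder's inequality.\<close>

lemma in_Lp_interval_bound:
  assumes "in_Lp p \<nu>" "p > 1"
  shows "\<exists>A\<ge>0. \<forall>a. \<forall>L>0. emeasure \<nu> {a..a + L} \<le> ennreal (A * L powr (1 - 1 / p))"
proof -
  obtain f :: "real \<Rightarrow> real" where f [measurable]: "f \<in> borel_measurable borel"
    and f0: "\<And>x. 0 \<le> f x" and \<nu>: "\<nu> = density lborel (\<lambda>x. ennreal (f x))"
    and int: "integrable lborel (\<lambda>x. \<bar>f x\<bar> powr p)"
    using assms(1) unfolding in_Lp_def by blast
  define B where "B = (\<integral>x. \<bar>f x\<bar> powr p \<partial>lborel)"
  have B0: "B \<ge> 0" unfolding B_def by (intro integral_nonneg_AE) auto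
  have B: "(\<integral>\<^sup>+x. ennreal (\<bar>f x\<bar> powr p) \<partial>lborel) = ennreal B"
    unfolding B_def by (intro nn_integral_eq_integral int) auto
  have "emeasure \<nu> {a..a + L} \<le> ennreal ((1 + B) * L powr (1 - 1 / p))" if L: "L > 0" for a L
  proof -
    define h where "h = L powr (- 1 / p)"
    have h: "h > 0" using L by (simp add: h_def)
    have hL: "h * L = L powr (1 - 1 / p)" "h powr (1 - p) = L powr (1 - 1 / p)"
      using L assms(2) powr_add[of L "- 1 / p" 1]
      by (simp_all add: h_def powr_powr diff_divide_distrib)
    have pt: "f x \<le> h + h powr (1 - p) * \<bar>f x\<bar> powr p" for x
    proof (cases "f x \<le> h")
      case False
      then have fx: "f x > h" by simp
      then have "f x = f x powr (1 - p) * f x powr p"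
        using h by (simp flip: powr_add)
      also have "\<dots> \<le> h powr (1 - p) * f x powr p"
        using fx h assms(2) by (intro mult_right_mono powr_mono2') auto
      finally show ?thesis using h f0[of x] by simp
    qed (simp add: add_increasing2)
    have "emeasure \<nu> {a..a + L} = (\<integral>\<^sup>+x. ennreal (f x) * indicator {a..a + L} x \<partial>lborel)"
      unfolding \<nu> by (simp add: emeasure_density)
    also have "\<dots> \<le> (\<integral>\<^sup>+x. ennreal h * indicator {a..a + L} x
                      + ennreal (h powr (1 - p)) * ennreal (\<bar>f x\<bar> powr p) \<partial>lborel)"
    proof (intro nn_integral_mono)
      fix x
      have "ennreal (f x) \<le> ennreal h + ennreal (h powr (1 - p)) * ennreal (\<bar>f x\<bar> powr p)"
        using pt[of x] h by (simp flip: ennreal_mult ennreal_plus)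
      then show "ennreal (f x) * indicator {a..a + L} x \<le> ennreal h * indicator {a..a + L} x
                      + ennreal (h powr (1 - p)) * ennreal (\<bar>f x\<bar> powr p)"
        by (auto simp: indicator_def)
    qed
    also have "\<dots> = ennreal h * ennreal L + ennreal (h powr (1 - p)) * ennreal B"
      using L by (simp add: nn_integral_add nn_integral_cmult B)
    also have "\<dots> = ennreal ((1 + B) * L powr (1 - 1 / p))"
      using h L B0 hL by (simp flip: ennreal_mult ennreal_plus add: algebra_simps)
    finally show ?thesis .
  qed
  then show ?thesis using B0 by (intro exI[of _ "1 + B"]) auto
qed

section \<open>Combs on the line and Frostman bounds from slices\<close>

text \<open>The hypothesis compares indices and positions, so \<open>S\<close> lies between two indices that differ by at
most \<open>L / h\<close>.\<close>

lemma card_le_of_separated: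
  fixes l :: "nat \<Rightarrow> real"
  assumes "finite S" "h > 0" "L \<ge> 0"
    and sep: "\<And>m m'. m \<in> S \<Longrightarrow> m' \<in> S \<Longrightarrow> m \<le> m' \<Longrightarrow> (real m' - real m) * h \<le> l m' - l m"
    and box: "\<And>m. m \<in> S \<Longrightarrow> l m \<in> {a..a + L}"
  shows "real (card S) \<le> L / h + 1"
proof (cases "S = {}")
  case False
  let ?u = "Min S" and ?v = "Max S"
  have uv: "?u \<in> S" "?v \<in> S" "?u \<le> ?v" using False assms(1) by auto
  have "(real ?v - real ?u) * h \<le> L" using sep[OF uv] box[OF uv(1)] box[OF uv(2)] by simp
  then have *: "real ?v - real ?u \<le> L / h" using assms(2) by (simp add: field_simps)
  have "card S \<le> card {?u..?v}" using assms(1) by (intro card_mono) auto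
  then have "real (card S) \<le> real (Suc ?v - ?u)" by simp
  also have "\<dots> = real ?v - real ?u + 1" using uv(3) by (simp add: of_nat_diff)
  finally show ?thesis using * by simp
qed (use assms in simp)

text \<open>A comb of \<open>M\<close> teeth of width \<open>d\<close>, density \<open>h / d\<close> and mutual distance at least \<open>h\<close> looks like
Lebesgue measure at scales above \<open>h\<close>, like a single tooth of mass \<open>h \<le> d powr (t - 1)\<close> at
scales between \<open>d\<close> and \<open>h\<close>, and like \<open>h / d\<close> times Lebesgue measure below \<open>d\<close>. All
three regimes stay below \<open>R powr (t - 1)\<close> because \<open>0 \<le> t - 1 < 1\<close>.\<close>

lemma comb_frostman:
  fixes l :: "nat \<Rightarrow> real" and t h d R a :: real
  assumes t: "1 \<le> t" "t < 2" and d: "0 < d" "d \<le> h" and Mh: "real M * h \<le> 1"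
    and hd: "h \<le> d powr (t - 1)" and R: "R > 0"
    and sep: "\<And>m m'. m \<le> m' \<Longrightarrow> m' < M \<Longrightarrow> (real m' - real m) * h \<le> l m' - l m"
  shows "h / d * (\<Sum>m<M. measure lborel ({l m..l m + d} \<inter> {a - R..a + R})) \<le> 8 * R powr (t - 1)"
proof -
  define S where "S = {m. m < M \<and> {l m..l m + d} \<inter> {a - R..a + R} \<noteq> {}}"
  have S: "finite S" "S \<subseteq> {..<M}" unfolding S_def by auto
  have one: "measure lborel ({u..u + d} \<inter> {a - R..a + R}) \<le> min d (2 * R)" for u
    using d R by (auto simp: min_def max_def)
  \<comment> \<open>A tooth that meets the interval starts at most \<open>d\<close> to the left of it.\<close>
  have cS: "real (card S) \<le> (2 * R + d) / h + 1"
    by (rule card_le_of_separated[where l = l and a = "a - R - d"])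
       (use S d R sep in \<open>auto simp: S_def\<close>)
  have dh: "d / h \<le> 1" using d by simp
  then have cS': "real (card S) \<le> 2 * R / h + 2" using cS by (simp add: add_divide_distrib)
  have cM: "real (card S) \<le> real M" using card_mono[OF _ S(2)] by simp
  have "(\<Sum>m<M. measure lborel ({l m..l m + d} \<inter> {a - R..a + R}))
        = (\<Sum>m\<in>S. measure lborel ({l m..l m + d} \<inter> {a - R..a + R}))"
    by (rule sum.mono_neutral_right) (auto simp: S_def)
  also have "\<dots> \<le> real (card S) * min d (2 * R)"
    using sum_bounded_above[of S _ "min d (2 * R)"] one by simp
  finally have "h / d * (\<Sum>m<M. measure lborel ({l m..l m + d} \<inter> {a - R..a + R}))
        \<le> h / d * (real (card S) * min d (2 * R))"
    using d by (intro mult_left_mono) auto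
  also have "\<dots> \<le> 8 * R powr (t - 1)"
  proof -
    consider "R \<ge> 1" | "d \<le> R" "R < 1" | "R < d" by linarith
    then show ?thesis
    proof cases
      case 1
      have "h / d * (real (card S) * min d (2 * R)) \<le> h / d * (real M * d)"
        using cM d R by (intro mult_left_mono mult_mono) auto
      also have "\<dots> \<le> 1" using Mh d by (simp add: mult.commute)
      also have "1 \<le> R powr (t - 1)" using 1 t by (simp add: ge_one_powr_ge_zero)
      finally show ?thesis using powr_ge_zero[of R "t - 1"] by linarith
    next
      case 2
      have "h / d * (real (card S) * min d (2 * R)) \<le> h / d * ((2 * R / h + 2) * d)"
        using cS' d R by (intro mult_left_mono mult_mono) auto
      also have "\<dots> = 2 * R powr 1 + 2 * h" using d R by (simp add: field_simps)
      also have "R powr 1 \<le> R powr (t - 1)" using 2 t R by (intro powr_mono') auto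
      also have "h \<le> R powr (t - 1)"
        using hd 2 d t by (meson order_trans powr_mono2 less_imp_le diff_ge_0_iff_ge)
      finally show ?thesis using powr_ge_zero[of R "t - 1"] by linarith
    next
      case 3
      have "2 * R / h + 2 \<le> 4" using 3 d by (simp add: field_simps)
      then have "h / d * (real (card S) * min d (2 * R)) \<le> h / d * (4 * (2 * R))"
        using cS' d R by (intro mult_left_mono mult_mono) auto
      also have "\<dots> \<le> d powr (t - 1) / d * (4 * (2 * R))"
        using hd d R by (intro mult_right_mono divide_right_mono) auto
      also have "\<dots> = 8 * (R * d powr (t - 2))"
        using d powr_diff[of d "t - 1" 1] by (simp add: algebra_simps)
      also have "d powr (t - 2) \<le> R powr (t - 2)" using 3 R t by (intro powr_mono2') auto
      also have "R * R powr (t - 2) = R powr (t - 1)"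
        using R powr_add[of R 1 "t - 2"] by simp
      finally show ?thesis using R by simp
    qed
  qed
  finally show ?thesis .
qed

text \<open>Fubini: the vertical side of the square contributes the missing factor \<open>2 * R\<close>.\<close>

lemma square_integral_le_of_slices:
  fixes f :: "real \<times> real \<Rightarrow> ennreal" and R C a b t :: real
  assumes f [measurable]: "f \<in> borel_measurable borel" and "R > 0" "C \<ge> 0"
    and slice: "\<And>y. (\<integral>\<^sup>+x. f (x, y) * indicator {a - R..a + R} x \<partial>lborel)
                       \<le> ennreal (C * R powr (t - 1))"
  shows "(\<integral>\<^sup>+z. f z * indicator ({a - R..a + R} \<times> {b - R..b + R}) z \<partial>lborel)
           \<le> ennreal (2 * C * R powr t)"
proof -
  have [measurable]: "{a - R..a + R} \<times> {b - R..b + R} \<in> sets borel"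
    by (intro borel_closed closed_Times) auto
  have m: "(\<lambda>z. f z * indicator ({a - R..a + R} \<times> {b - R..b + R}) z)
             \<in> borel_measurable (lborel \<Otimes>\<^sub>M lborel)"
    unfolding lborel_prod by measurable
  have "(\<integral>\<^sup>+z. f z * indicator ({a - R..a + R} \<times> {b - R..b + R}) z \<partial>lborel)
     = (\<integral>\<^sup>+y. \<integral>\<^sup>+x. f (x, y) * indicator ({a - R..a + R} \<times> {b - R..b + R}) (x, y) \<partial>lborel \<partial>lborel)"
    unfolding lborel_pair.nn_integral_snd[OF m] by (simp add: lborel_prod)
  also have "\<dots> = (\<integral>\<^sup>+y. (\<integral>\<^sup>+x. f (x, y) * indicator {a - R..a + R} x \<partial>lborel)
                     * indicator {b - R..b + R} y \<partial>lborel)"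
    by (intro nn_integral_cong) (auto simp: indicator_def)
  also have "\<dots> \<le> (\<integral>\<^sup>+y. ennreal (C * R powr (t - 1)) * indicator {b - R..b + R} y \<partial>lborel)"
    by (intro nn_integral_mono mult_right_mono slice) auto
  also have "\<dots> = ennreal (C * R powr (t - 1)) * ennreal (2 * R)"
    using assms(2) by (subst nn_integral_cmult_indicator) auto
  also have "\<dots> = ennreal (2 * C * R powr t)"
    using assms(2,3) powr_add[of R 1 "t - 1"] by (simp flip: ennreal_mult add: algebra_simps)
  finally show ?thesis .
qed

section \<open>The needles of one scale\<close>

text \<open>The needle number \<open>j * M + m\<close> is the \<open>m\<close>-th needle of the \<open>j\<close>-th strip. The slopes run through
\<open>J * M\<close> equally spaced values starting at \<open>-1\<close>; a slope is the rate of change of the horizontal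
coordinate with respect to the vertical one.\<close>

definition needle_slope :: "nat \<Rightarrow> nat \<Rightarrow> nat \<Rightarrow> nat \<Rightarrow> real" where
  "needle_slope J M j m = 2 * real (j * M + m) / (real J * real M) - 1"

text \<open>The needles start at the bottom line of their strip with abscissae in \<open>[1/4, 1/2]\<close>. This leaves
room for the horizontal drift, at most \<open>1/J\<close>, inside the unit square.\<close>

definition needle_left :: "nat \<Rightarrow> nat \<Rightarrow> nat \<Rightarrow> nat \<Rightarrow> real \<Rightarrow> real" where
  "needle_left J M j m y =
     1/4 + real m / (4 * real M) + needle_slope J M j m * (y - real j / real J)"

definition needle_width :: "nat \<Rightarrow> nat \<Rightarrow> real" where
  "needle_width J M = 1 / (real J ^ 2 * real M)"

definition strip :: "nat \<Rightarrow> nat \<Rightarrow> real set" where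
  "strip J j = {real j / real J..<real (Suc j) / real J}"

definition needle :: "nat \<Rightarrow> nat \<Rightarrow> nat \<Rightarrow> nat \<Rightarrow> (real \<times> real) set" where
  "needle J M j m = {z. snd z \<in> strip J j \<and>
     fst z \<in> {needle_left J M j m (snd z)..needle_left J M j m (snd z) + needle_width J M}}"

text \<open>The factor is the ratio of the gap \<open>1 / (4 * M)\<close> between needles and their width.\<close>

definition needle_density :: "nat \<Rightarrow> nat \<Rightarrow> real \<times> real \<Rightarrow> ennreal" where
  "needle_density J M z =
     ennreal (real J ^ 2 / 4) * (\<Sum>j<J. \<Sum>m<M. indicator (needle J M j m) z)"

lemma needle_sets [measurable]: "needle J M j m \<in> sets borel"
proof -
  have "{z \<in> space (borel \<Otimes>\<^sub>M borel). snd z \<in> strip J j \<and>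
     fst z \<in> {needle_left J M j m (snd z)..needle_left J M j m (snd z) + needle_width J M}}
     \<in> sets (borel \<Otimes>\<^sub>M borel)"
    unfolding strip_def atLeastAtMost_iff atLeastLessThan_iff needle_left_def by measurable
  then show ?thesis unfolding borel_prod by (simp add: needle_def)
qed

lemma needle_density_measurable [measurable]:
  "needle_density J M \<in> borel_measurable borel"
  unfolding needle_density_def[abs_def] by measurable

lemma abs_needle_slope_le:
  assumes "j < J" "m < M"
  shows "\<bar>needle_slope J M j m\<bar> \<le> 1"
proof -
  have "j * M + m \<le> J * M"
    using mult_le_mono1[of "Suc j" J M] assms by auto
  then have "real (j * M + m) \<le> real J * real M" by (metis of_nat_le_iff of_nat_mult)
  then have "real (j * M + m) / (real J * real M) \<le> 1" using assms by (simp add: divide_le_eq_1)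
  moreover have "0 \<le> real (j * M + m) / (real J * real M)" by simp
  ultimately show ?thesis unfolding needle_slope_def
    by (simp only: times_divide_eq_right[symmetric] abs_le_iff) linarith
qed

lemma needle_subset_unit_square:
  assumes J: "J \<ge> 4" and jm: "j < J" "m < M"
  shows "needle J M j m \<subseteq> {0..1} \<times> {0..1}"
proof safe
  fix x y assume "(x, y) \<in> needle J M j m"
  then have y: "real j / real J \<le> y" "y < real (Suc j) / real J"
    and x: "needle_left J M j m y \<le> x" "x \<le> needle_left J M j m y + needle_width J M"
    by (auto simp: needle_def strip_def)
  have J': "1 / real J \<le> 1/4" using J by (simp add: field_simps)
  have "y - real j / real J \<le> 1/4" using y(2) J' by (simp add: add_divide_distrib)
  then have "\<bar>y - real j / real J\<bar> \<le> 1/4" using y(1) by simp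
  then have "\<bar>needle_slope J M j m * (y - real j / real J)\<bar> \<le> 1 * (1/4)"
    unfolding abs_mult using abs_needle_slope_le[OF jm] by (intro mult_mono) auto
  moreover have "real m / (4 * real M) \<le> 1/4" using jm by (simp add: field_simps)
  moreover have "0 \<le> real m / (4 * real M)" by simp
  moreover have "needle_width J M \<le> 1/4"
  proof -
    have "4 * 1 \<le> real J ^ 2 * real M"
      using J jm power_mono[of 2 "real J" 2] by (intro mult_mono) auto
    then show ?thesis unfolding needle_width_def using J jm by (simp add: field_simps)
  qed
  ultimately have "0 \<le> x" "x \<le> 1" using x unfolding needle_left_def by linarith+
  then show "x \<in> {0..1}" by simp
  have "real (Suc j) / real J \<le> 1" using jm J by (simp add: field_simps)
  then show "y \<in> {0..1}" using y order_trans[OF _ y(1), of 0] by auto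
qed

lemma needle_density_eq_0:
  assumes "J \<ge> 4" "z \<notin> {0..1} \<times> {0..1}"
  shows "needle_density J M z = 0"
proof -
  have "z \<notin> needle J M j m" if "j < J" "m < M" for j m
    using needle_subset_unit_square[OF assms(1) that] assms(2) by blast
  then show ?thesis by (simp add: needle_density_def)
qed

lemma strip_unique:
  assumes "y \<in> strip J i" "y \<in> strip J j" "J > 0"
  shows "i = j"
proof -
  have "\<lfloor>real J * y\<rfloor> = int k" if "y \<in> strip J k" for k
    using that assms(3) by (intro floor_unique) (auto simp: strip_def field_simps)
  then show ?thesis using assms by (metis of_nat_eq_iff)
qed

text \<open>A horizontal line meets only one strip, and there the needles fan out upwards: those to the right
have larger slope, so their distance at height \<open>y\<close> is at least the distance \<open>1 / (4 * M)\<close> at the bottom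
line. The slice is therefore a comb.\<close>

lemma needle_density_slice:
  fixes t R a y :: real
  assumes t: "1 \<le> t" "t < 2" and J: "J \<ge> 4" and M: "M > 0" and R: "R > 0"
    and hd: "1 / (4 * real M) \<le> needle_width J M powr (t - 1)"
  shows "(\<integral>\<^sup>+x. needle_density J M (x, y) * indicator {a - R..a + R} x \<partial>lborel)
           \<le> ennreal (8 * R powr (t - 1))"
proof (cases "\<exists>j<J. y \<in> strip J j")
  case True
  then obtain j where j: "j < J" "y \<in> strip J j" by blast
  define l where "l m = needle_left J M j m y" for m
  define d where "d = needle_width J M"
  have d: "d > 0" using J M by (simp add: d_def needle_width_def)
  have dens: "needle_density J M (x, y)
      = ennreal (real J ^ 2 / 4) * (\<Sum>m<M. indicator {l m..l m + d} x)" for x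
  proof -
    have "(\<Sum>i<J. \<Sum>m<M. indicator (needle J M i m) (x, y) :: ennreal)
          = (\<Sum>i\<in>{j}. \<Sum>m<M. indicator (needle J M i m) (x, y))"
      using j J strip_unique[of y J]
      by (intro sum.mono_neutral_right) (auto simp: needle_def indicator_def intro!: sum.neutral)
    also have "\<dots> = (\<Sum>m<M. indicator {l m..l m + d} x)"
      using j(2) by (simp add: needle_def l_def d_def indicator_def)
    finally show ?thesis by (simp add: needle_density_def)
  qed
  have "(\<integral>\<^sup>+x. needle_density J M (x, y) * indicator {a - R..a + R} x \<partial>lborel)
      = (\<integral>\<^sup>+x. ennreal (real J ^ 2 / 4) *
           (\<Sum>m<M. indicator ({l m..l m + d} \<inter> {a - R..a + R}) x) \<partial>lborel)"
    by (simp add: dens mult.assoc sum_distrib_right flip: indicator_inter_arith)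
  also have "\<dots> = ennreal (real J ^ 2 / 4) *
           (\<Sum>m<M. emeasure lborel ({l m..l m + d} \<inter> {a - R..a + R}))"
    by (subst nn_integral_cmult, simp, subst nn_integral_sum) auto
  also have "\<dots> = ennreal (real J ^ 2 / 4 *
           (\<Sum>m<M. measure lborel ({l m..l m + d} \<inter> {a - R..a + R})))"
  proof -
    have "emeasure lborel ({l m..l m + d} \<inter> {a - R..a + R})
       = ennreal (measure lborel ({l m..l m + d} \<inter> {a - R..a + R}))" for m
      by (intro emeasure_eq_ennreal_measure) (simp add: Int_atLeastAtMost emeasure_lborel_Icc_eq)
    then show ?thesis by (simp only: sum_ennreal measure_nonneg ennreal_mult sum_nonneg
          zero_le_divide_iff zero_le_power2 zero_le_numeral simp_thms)
  qed
  also have "\<dots> \<le> ennreal (8 * R powr (t - 1))"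
  proof (intro ennreal_leI)
    define h where "h = 1 / (4 * real M)"
    have hq: "h / d = real J ^ 2 / 4" using J M by (simp add: h_def d_def needle_width_def)
    have sep: "(real m' - real m) * h \<le> l m' - l m" if "m \<le> m'" "m' < M" for m m'
    proof -
      have "l m' - l m = (real m' - real m) * h
              + 2 * (real m' - real m) / (real J * real M) * (y - real j / real J)"
        unfolding l_def needle_left_def needle_slope_def h_def
        by (simp add: diff_divide_distrib add_divide_distrib algebra_simps)
      moreover have "0 \<le> 2 * (real m' - real m) / (real J * real M) * (y - real j / real J)"
        using that j(2) by (intro mult_nonneg_nonneg divide_nonneg_nonneg) (auto simp: strip_def)
      ultimately show ?thesis by simp
    qed
    have "d \<le> h"
    proof -
      have "4 * real M \<le> real J ^ 2 * real M"
        using J power_mono[of 2 "real J" 2] by (intro mult_right_mono) auto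
      then show ?thesis unfolding d_def h_def needle_width_def
        using J M by (intro divide_left_mono) auto
    qed
    moreover have "real M * h \<le> 1" using M by (simp add: h_def)
    moreover have "h \<le> d powr (t - 1)" using hd by (simp only: h_def d_def)
    ultimately show "real J ^ 2 / 4 * (\<Sum>m<M. measure lborel ({l m..l m + d} \<inter> {a - R..a + R}))
        \<le> 8 * R powr (t - 1)"
      unfolding hq[symmetric] using comb_frostman[OF t d _ _ _ R sep] by blast
  qed
  finally show ?thesis .
next
  case False
  then have "needle_density J M (x, y) = 0" for x
    by (auto simp: needle_density_def needle_def intro!: sum.neutral)
  then show ?thesis by simp
qed

section \<open>Heavy tubes in every direction\<close>

lemma emeasure_needle:
  assumes J: "J > 0"
  shows "emeasure lborel (needle J M j m) = ennreal (needle_width J M / real J)"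
proof -
  let ?d = "needle_width J M"
  have d: "?d \<ge> 0" by (simp add: needle_width_def)
  have "emeasure lborel (needle J M j m) = (\<integral>\<^sup>+z. indicator (needle J M j m) z \<partial>lborel)"
    by simp
  also have "\<dots> = (\<integral>\<^sup>+y. \<integral>\<^sup>+x. indicator (needle J M j m) (x, y) \<partial>lborel \<partial>lborel)"
    using lborel_pair.nn_integral_snd[of "indicator (needle J M j m)"]
    by (simp add: lborel_prod)
  also have "\<dots> = (\<integral>\<^sup>+y. (\<integral>\<^sup>+x. indicator {needle_left J M j m y..needle_left J M j m y + ?d} x \<partial>lborel)
                      * indicator (strip J j) y \<partial>lborel)"
    by (intro nn_integral_cong) (auto simp: needle_def indicator_def)
  also have "\<dots> = (\<integral>\<^sup>+y. ennreal ?d * indicator (strip J j) y \<partial>lborel)"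
    using d by simp
  also have "\<dots> = ennreal ?d * emeasure lborel (strip J j)"
    by (intro nn_integral_cmult_indicator) (simp add: strip_def)
  also have "emeasure lborel (strip J j) = ennreal (1 / real J)"
    using J unfolding strip_def by (subst emeasure_lborel_Ico) (auto simp: field_simps)
  finally show ?thesis using d by (simp flip: ennreal_mult)
qed

text \<open>Rounding down can produce the index \<open>J * M\<close>, one too many, when \<open>s = 1\<close>; the last needle is
then still close enough.\<close>

lemma exists_needle_slope_near:
  assumes J: "J > 0" and M: "M > 0" and s: "\<bar>s\<bar> \<le> 1"
  shows "\<exists>j<J. \<exists>m<M. \<bar>needle_slope J M j m - s\<bar> \<le> 2 / (real J * real M)"
proof -
  define N where "N = J * M"
  have N: "N > 0" "real N > 0" using J M by (auto simp: N_def)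
  define q where "q = (s + 1) / 2 * real N"
  have q: "0 \<le> q" "q \<le> real N"
    using s N mult_right_mono[of "(s + 1) / 2" 1 "real N"] by (auto simp: q_def)
  define i where "i = min (nat \<lfloor>q\<rfloor>) (N - 1)"
  have i: "i < N" using N by (auto simp: i_def)
  have "\<bar>real i - q\<bar> \<le> 1"
  proof (cases "nat \<lfloor>q\<rfloor> \<le> N - 1")
    case True
    then have "real i = of_int \<lfloor>q\<rfloor>" using q by (simp add: i_def)
    then show ?thesis by linarith
  next
    case False
    then have "real i = real N - 1" "real N \<le> q"
      using N q by (auto simp: i_def of_nat_diff) linarith
    then show ?thesis using q by simp
  qed
  then have "2 / real N * \<bar>real i - q\<bar> \<le> 2 / real N"
    using N mult_left_mono[of "\<bar>real i - q\<bar>" 1 "2 / real N"] by simp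
  moreover have "2 / real N * \<bar>real i - q\<bar> = \<bar>2 / real N * (real i - q)\<bar>"
    using N by (simp only: abs_mult) simp
  moreover have "2 / real N * (real i - q) = needle_slope J M (i div M) (i mod M) - s"
    using N by (simp add: needle_slope_def q_def N_def field_simps)
  moreover have "i div M < J" using i by (simp add: N_def less_mult_imp_div_less)
  moreover have "i mod M < M" using M by simp
  ultimately show ?thesis unfolding N_def by (metis of_nat_mult)
qed

text \<open>Take a needle whose slope is nearly \<open>s\<close>. Over the height \<open>1/J\<close> of a strip the slope error
\<open>2 / (J * M)\<close> produces a deviation of at most two needle widths to either side; with the width
itself this gives the factor \<open>5\<close>.\<close>

lemma needle_density_heavy_tube:
  assumes J: "J > 0" and M: "M > 0" and s: "\<bar>s\<bar> \<le> 1"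
  shows "\<exists>a. ennreal (1 / (4 * real J * real M)) \<le>
     (\<integral>\<^sup>+z. needle_density J M z *
        indicator {z. fst z - s * snd z \<in> {a..a + 5 * needle_width J M}} z \<partial>lborel)"
proof -
  obtain j m where jm: "j < J" "m < M"
    and near: "\<bar>needle_slope J M j m - s\<bar> \<le> 2 / (real J * real M)"
    using exists_needle_slope_near[OF assms] by blast
  define d where "d = needle_width J M"
  define a where "a = 1/4 + real m / (4 * real M) - s * (real j / real J) - 2 * d"
  have sub: "fst z - s * snd z \<in> {a..a + 5 * d}" if "z \<in> needle J M j m" for z
  proof -
    let ?y = "snd z - real j / real J"
    have y: "0 \<le> ?y" "?y \<le> 1 / real J"
      and x: "needle_left J M j m (snd z) \<le> fst z" "fst z \<le> needle_left J M j m (snd z) + d"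
      using that by (auto simp: needle_def strip_def d_def add_divide_distrib)
    have "\<bar>(needle_slope J M j m - s) * ?y\<bar> \<le> 2 / (real J * real M) * (1 / real J)"
      unfolding abs_mult using near y by (intro mult_mono) auto
    also have "\<dots> = 2 * d" by (simp add: d_def needle_width_def power2_eq_square)
    finally have "\<bar>(needle_slope J M j m - s) * ?y\<bar> \<le> 2 * d" .
    moreover have "needle_left J M j m (snd z) - s * snd z
        = a + 2 * d + (needle_slope J M j m - s) * ?y"
      by (simp add: needle_left_def a_def algebra_simps)
    ultimately show ?thesis using x by auto
  qed
  have le: "ennreal (real J ^ 2 / 4) * indicator (needle J M j m) z \<le> needle_density J M z *
        indicator {z. fst z - s * snd z \<in> {a..a + 5 * d}} z" for z
  proof (cases "z \<in> needle J M j m")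
    case True
    have "(1::ennreal) = indicator (needle J M j m) z" using True by simp
    also have "\<dots> \<le> (\<Sum>m<M. indicator (needle J M j m) z)"
      using jm by (intro member_le_sum) auto
    also have "\<dots> \<le> (\<Sum>j<J. \<Sum>m<M. indicator (needle J M j m) z)"
      using jm by (intro member_le_sum[of j _ "\<lambda>j. \<Sum>m<M. indicator (needle J M j m) z"]) auto
    finally have "ennreal (real J ^ 2 / 4) * 1 \<le> needle_density J M z"
      unfolding needle_density_def by (intro mult_left_mono) auto
    then show ?thesis using True sub[OF True] by simp
  qed simp
  have "ennreal (1 / (4 * real J * real M)) = ennreal (real J ^ 2 / 4) * ennreal (d / real J)"
    using J M by (simp flip: ennreal_mult add: d_def needle_width_def power2_eq_square)
  also have "\<dots> = (\<integral>\<^sup>+z. ennreal (real J ^ 2 / 4) * indicator (needle J M j m) z \<partial>lborel)"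
    using emeasure_needle[OF J]
    by (subst nn_integral_cmult_indicator) (simp_all add: d_def)
  also have "\<dots> \<le> (\<integral>\<^sup>+z. needle_density J M z *
        indicator {z. fst z - s * snd z \<in> {a..a + 5 * d}} z \<partial>lborel)"
    by (intro nn_integral_mono le)
  finally show ?thesis unfolding d_def by blast
qed

text \<open>For a unit vector \<open>\<theta> = (u, v)\<close> the projection is \<open>- v * x + u * y\<close>. Dividing by the coordinate of
larger modulus turns it into \<open>x - s * y\<close> or \<open>y - s * x\<close> with \<open>\<bar>s\<bar> \<le> 1\<close>, and multiplying
back by that coordinate does not lengthen intervals.\<close>

lemma proj_tube:
  assumes "\<theta> \<in> sphere 0 1"
  shows "\<exists>s. \<bar>s\<bar> \<le> 1 \<and>
    ((\<forall>a L. L \<ge> 0 \<longrightarrow> (\<exists>q. \<forall>z. fst z - s * snd z \<in> {a..a + L} \<longrightarrow>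
         proj \<theta> (vector [fst z, snd z]) \<in> {q..q + L})) \<or>
     (\<forall>a L. L \<ge> 0 \<longrightarrow> (\<exists>q. \<forall>z. snd z - s * fst z \<in> {a..a + L} \<longrightarrow>
         proj \<theta> (vector [fst z, snd z]) \<in> {q..q + L})))"
proof -
  define u v where "u = \<theta> $ 1" and "v = \<theta> $ 2"
  have "u\<^sup>2 + v\<^sup>2 = 1"
    using assms by (simp add: u_def v_def norm_vec_def L2_set_def sum_2 dist_norm)
  then have uv: "\<bar>u\<bar> \<le> 1" "\<bar>v\<bar> \<le> 1" "u \<noteq> 0 \<or> v \<noteq> 0"
    by (auto simp: abs_square_le_1[symmetric]) (smt (verit) zero_le_power2)+
  have proj: "proj \<theta> (vector [fst z, snd z]) = - v * fst z + u * snd z" for z :: "real \<times> real"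
    by (simp add: proj_def perp_def inner_vec_def sum_2 u_def v_def)
  have mult: "\<exists>q. \<forall>w. w \<in> {a..a + L} \<longrightarrow> c * w \<in> {q..q + L}"
    if "\<bar>c\<bar> \<le> 1" "L \<ge> 0" for c a L :: real
  proof (cases "c \<ge> 0")
    case True
    have "c * w \<in> {c * a..c * a + L}" if "w \<in> {a..a + L}" for w
      using that \<open>\<bar>c\<bar> \<le> 1\<close> True \<open>L \<ge> 0\<close> mult_left_mono[of a w c] mult_left_mono[of w "a + L" c]
        mult_right_mono[of c 1 L] by (auto simp: algebra_simps)
    then show ?thesis by blast
  next
    case False
    have "c * w \<in> {c * (a + L)..c * (a + L) + L}" if "w \<in> {a..a + L}" for w
    proof -
      have "c * w \<le> c * a" "c * (a + L) \<le> c * w"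
        using that False by (auto intro!: mult_left_mono_neg)
      moreover have "- c * L \<le> 1 * L" using that \<open>\<bar>c\<bar> \<le> 1\<close> \<open>L \<ge> 0\<close> by (intro mult_right_mono) auto
      ultimately show ?thesis by (simp add: algebra_simps)
    qed
    then show ?thesis by blast
  qed
  show ?thesis
  proof (cases "\<bar>u\<bar> \<le> \<bar>v\<bar>")
    case True
    then have v: "v \<noteq> 0" using uv by auto
    have "proj \<theta> (vector [fst z, snd z]) = - v * (fst z - u / v * snd z)" for z :: "real \<times> real"
      unfolding proj using v by (simp add: algebra_simps)
    then have "\<exists>q. \<forall>z. fst z - u / v * snd z \<in> {a..a + L} \<longrightarrow>
         proj \<theta> (vector [fst z, snd z]) \<in> {q..q + L}" if "L \<ge> 0" for a L
      using mult[of "- v" L a] uv that by (simp only: abs_minus_cancel) blast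
    moreover have "\<bar>u / v\<bar> \<le> 1" using True v by simp
    ultimately show ?thesis by blast
  next
    case False
    then have u: "u \<noteq> 0" by auto
    have "proj \<theta> (vector [fst z, snd z]) = u * (snd z - v / u * fst z)" for z :: "real \<times> real"
      unfolding proj using u by (simp add: algebra_simps)
    then have "\<exists>q. \<forall>z. snd z - v / u * fst z \<in> {a..a + L} \<longrightarrow>
         proj \<theta> (vector [fst z, snd z]) \<in> {q..q + L}" if "L \<ge> 0" for a L
      using mult[of u L a] uv that by (simp only:) blast
    moreover have "\<bar>v / u\<bar> \<le> 1" using False u by simp
    ultimately show ?thesis by blast
  qed
qed

section \<open>The sum over all scales\<close>

lemma vector2_measurable:
  "(\<lambda>z. vector [fst z, snd z] :: real^2) \<in> borel_measurable borel"
proof -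
  have "(\<lambda>z. vector [fst z, snd z] :: real^2)
      = (\<lambda>z. fst z *\<^sub>R axis 1 1 + snd z *\<^sub>R axis 2 1)"
    by (auto simp: fun_eq_iff vec_eq_iff forall_2 axis_def)
  moreover have "continuous_on UNIV \<dots>" by (intro continuous_intros)
  ultimately show ?thesis by (metis borel_measurable_continuous_onI)
qed

lemma swap_measurable: "(prod.swap :: real \<times> real \<Rightarrow> real \<times> real) \<in> borel_measurable borel"
  by (intro borel_measurable_continuous_onI continuous_on_swap)

lemma nn_integral_swap:
  fixes f :: "real \<times> real \<Rightarrow> ennreal"
  assumes "f \<in> borel_measurable borel"
  shows "(\<integral>\<^sup>+z. f (prod.swap z) \<partial>lborel) = (\<integral>\<^sup>+z. f z \<partial>lborel)"
proof -
  have f: "f \<in> borel_measurable (lborel \<Otimes>\<^sub>M lborel)" using assms by (simp add: lborel_prod)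
  have "(\<lambda>z. f (prod.swap z)) \<in> borel_measurable (lborel \<Otimes>\<^sub>M lborel)"
    using measurable_compose[OF swap_measurable assms] by (simp add: lborel_prod)
  from lborel_pair.nn_integral_snd[OF this] lborel.nn_integral_fst[OF f]
  show ?thesis by (simp add: lborel_prod)
qed

text \<open>Working with a density on \<open>real \<times> real\<close> makes Fubini's theorem available; the second summand is the
reflection in the diagonal.\<close>

definition needle_measure :: "(nat \<Rightarrow> nat) \<Rightarrow> (nat \<Rightarrow> nat) \<Rightarrow> (real^2) measure" where
  "needle_measure J M =
     distr (density lborel (\<lambda>z. \<Sum>k. ennreal ((1/2) ^ k) *
        (needle_density (J k) (M k) z + needle_density (J k) (M k) (prod.swap z))))
       borel (\<lambda>z. vector [fst z, snd z])"

lemma sets_needle_measure [simp]: "sets (needle_measure J M) = sets borel"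
  by (simp add: needle_measure_def)

lemma emeasure_needle_measure:
  assumes A [measurable]: "A \<in> sets borel"
  shows "emeasure (needle_measure J M) A = (\<Sum>k. ennreal ((1/2) ^ k) *
     ((\<integral>\<^sup>+z. needle_density (J k) (M k) z * indicator A (vector [fst z, snd z]) \<partial>lborel) +
      (\<integral>\<^sup>+z. needle_density (J k) (M k) z * indicator A (vector [snd z, fst z]) \<partial>lborel)))"
proof -
  let ?V = "\<lambda>z. vector [fst z, snd z] :: real^2"
  note [measurable] = vector2_measurable swap_measurable
  let ?f = "\<lambda>k. needle_density (J k) (M k)"
  have swap: "(\<integral>\<^sup>+z. ?f k (prod.swap z) * indicator A (?V z) \<partial>lborel)
           = (\<integral>\<^sup>+z. ?f k z * indicator A (vector [snd z, fst z]) \<partial>lborel)" for k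
  proof -
    have "(\<lambda>z. ?f k z * indicator A (?V (prod.swap z))) \<in> borel_measurable borel" by measurable
    from nn_integral_swap[OF this] show ?thesis by simp
  qed
  have "emeasure (needle_measure J M) A = (\<integral>\<^sup>+z. (\<Sum>k. ennreal ((1/2) ^ k) *
        (?f k z + ?f k (prod.swap z))) * indicator (?V -` A \<inter> space lborel) z \<partial>lborel)"
    unfolding needle_measure_def
    using measurable_sets_borel[OF vector2_measurable A]
    by (subst emeasure_distr, measurable, subst emeasure_density) simp_all
  also have "\<dots> = (\<integral>\<^sup>+z. (\<Sum>k. ennreal ((1/2) ^ k) *
        (?f k z * indicator A (?V z) + ?f k (prod.swap z) * indicator A (?V z))) \<partial>lborel)"
    by (intro nn_integral_cong) (auto simp: indicator_def)
  also have "\<dots> = (\<Sum>k. ennreal ((1/2) ^ k) * ((\<integral>\<^sup>+z. ?f k z * indicator A (?V z) \<partial>lborel) +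
        (\<integral>\<^sup>+z. ?f k (prod.swap z) * indicator A (?V z) \<partial>lborel)))"
    by (simp add: nn_integral_suminf nn_integral_cmult nn_integral_add)
  finally show ?thesis unfolding swap .
qed

lemma emeasure_needle_measure_outside:
  assumes "\<And>k. J k \<ge> 4"
  shows "emeasure (needle_measure J M) (- cbox 0 1) = 0"
proof -
  have zero: "needle_density (J k) (M k) z * indicator (- cbox 0 1) (vector [fst z, snd z] :: real^2) = 0"
    "needle_density (J k) (M k) z * indicator (- cbox 0 1) (vector [snd z, fst z] :: real^2) = 0"
    for k z
    using needle_density_eq_0[OF assms[of k], of z "M k"]
    by (cases z; force simp: indicator_def mem_box_cart forall_2)+
  have "- cbox 0 1 \<in> sets (borel :: (real^2) measure)" by simp
  from emeasure_needle_measure[OF this, of J M] show ?thesis unfolding zero by simp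
qed

text \<open>A ball lies in a square, where each of the two needle densities of each scale has mass at most
\<open>16 * R powr t\<close>; the weights sum to \<open>2\<close>.\<close>

lemma frostman_needle_measure:
  assumes t: "1 \<le> t" "t < 2" and J: "\<And>k. J k \<ge> 4" and M: "\<And>k. M k > 0"
    and hd: "\<And>k. 1 / (4 * real (M k)) \<le> needle_width (J k) (M k) powr (t - 1)"
  shows "frostman t (needle_measure J M)"
  unfolding frostman_def
proof (intro exI[of _ 64] conjI allI impI)
  fix c :: "real^2" and R :: real assume R: "R > 0"
  have sq: "(\<integral>\<^sup>+z. needle_density (J k) (M k) z *
              indicator ({a - R..a + R} \<times> {b - R..b + R}) z \<partial>lborel) \<le> ennreal (16 * R powr t)"
    for k a b
    using square_integral_le_of_slices[where C = 8 and f = "needle_density (J k) (M k)"]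
      needle_density_slice[OF t J M R hd] R by simp
  have ball: "\<bar>x - c $ 1\<bar> \<le> R \<and> \<bar>y - c $ 2\<bar> \<le> R" if "vector [x, y] \<in> ball c R" for x y
  proof -
    have "norm (vector [x, y] - c) \<le> R" using that by (simp add: dist_norm norm_minus_commute)
    then show ?thesis
      using component_le_norm_cart[of "vector [x, y] - c" 1]
        component_le_norm_cart[of "vector [x, y] - c" 2] by simp
  qed
  have "emeasure (needle_measure J M) (ball c R)
      \<le> (\<Sum>k. ennreal ((1/2) ^ k) * (ennreal (16 * R powr t) + ennreal (16 * R powr t)))"
    unfolding emeasure_needle_measure[OF borel_open[OF open_ball]]
  proof (intro suminf_le summableI mult_left_mono add_mono)
    fix k
    show "(\<integral>\<^sup>+z. needle_density (J k) (M k) z * indicator (ball c R) (vector [fst z, snd z]) \<partial>lborel)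
        \<le> ennreal (16 * R powr t)"
      by (rule order_trans[OF nn_integral_mono sq[of k "c $ 1" "c $ 2"]])
         (use ball in \<open>force simp: indicator_def abs_le_iff intro!: mult_left_mono\<close>)
    show "(\<integral>\<^sup>+z. needle_density (J k) (M k) z * indicator (ball c R) (vector [snd z, fst z]) \<partial>lborel)
        \<le> ennreal (16 * R powr t)"
      by (rule order_trans[OF nn_integral_mono sq[of k "c $ 2" "c $ 1"]])
         (use ball in \<open>force simp: indicator_def abs_le_iff intro!: mult_left_mono\<close>)
  qed auto
  also have "\<dots> = (\<Sum>k. ennreal ((1/2) ^ k * (32 * R powr t)))"
    by (simp flip: ennreal_mult ennreal_plus)
  also have "\<dots> = ennreal (\<Sum>k. (1/2) ^ k * (32 * R powr t))"
    by (intro suminf_ennreal2 summable_mult2 summable_geometric) auto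
  also have "(\<Sum>k. (1/2) ^ k * (32 * R powr t)) = 64 * R powr t"
    by (subst suminf_mult2[symmetric]) (auto intro: summable_geometric simp: suminf_geometric)
  finally show "emeasure (needle_measure J M) (ball c R) \<le> ennreal (64 * R powr t)" .
qed simp

lemma needle_measure_heavy_interval:
  assumes J: "J k > 0" and M: "M k > 0" and \<theta>: "\<theta> \<in> sphere 0 1"
  shows "\<exists>q. ennreal ((1/2) ^ k / (4 * real (J k) * real (M k))) \<le>
    emeasure (proj_measure \<theta> (needle_measure J M)) {q..q + 5 * needle_width (J k) (M k)}"
proof -
  let ?d = "needle_width (J k) (M k)" and ?f = "needle_density (J k) (M k)"
  have d: "5 * ?d \<ge> 0" by (simp add: needle_width_def)
  have projm: "proj \<theta> \<in> borel_measurable borel"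
    unfolding proj_def by (intro borel_measurable_continuous_onI continuous_intros)
  obtain s where s: "\<bar>s\<bar> \<le> 1"
    and tube: "(\<forall>a L. L \<ge> 0 \<longrightarrow> (\<exists>q. \<forall>z. fst z - s * snd z \<in> {a..a + L} \<longrightarrow>
         proj \<theta> (vector [fst z, snd z]) \<in> {q..q + L})) \<or>
     (\<forall>a L. L \<ge> 0 \<longrightarrow> (\<exists>q. \<forall>z. snd z - s * fst z \<in> {a..a + L} \<longrightarrow>
         proj \<theta> (vector [fst z, snd z]) \<in> {q..q + L}))"
    using proj_tube[OF \<theta>] by blast
  obtain a where a: "ennreal (1 / (4 * real (J k) * real (M k))) \<le>
     (\<integral>\<^sup>+z. ?f z * indicator {z. fst z - s * snd z \<in> {a..a + 5 * ?d}} z \<partial>lborel)" (is "?m \<le> ?I")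
    using needle_density_heavy_tube[of "J k" "M k", OF J M s] by blast
  obtain q where q: "(\<forall>z. fst z - s * snd z \<in> {a..a + 5 * ?d} \<longrightarrow>
         proj \<theta> (vector [fst z, snd z]) \<in> {q..q + 5 * ?d}) \<or>
     (\<forall>z. fst z - s * snd z \<in> {a..a + 5 * ?d} \<longrightarrow>
         proj \<theta> (vector [snd z, fst z]) \<in> {q..q + 5 * ?d})"
    using tube d by (metis fst_swap snd_swap)
  define A where "A = proj \<theta> -` {q..q + 5 * ?d}"
  have A: "A \<in> sets borel" using measurable_sets[OF projm, of "{q..q + 5 * ?d}"] by (simp add: A_def)
  have "?I \<le> (\<integral>\<^sup>+z. ?f z * indicator A (vector [fst z, snd z]) \<partial>lborel) +
      (\<integral>\<^sup>+z. ?f z * indicator A (vector [snd z, fst z]) \<partial>lborel)" (is "_ \<le> ?X + ?Y")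
  proof -
    from q have "?I \<le> ?X \<or> ?I \<le> ?Y"
    proof (elim disjE)
      assume *: "\<forall>z. fst z - s * snd z \<in> {a..a + 5 * ?d} \<longrightarrow>
         proj \<theta> (vector [fst z, snd z]) \<in> {q..q + 5 * ?d}"
      have "?I \<le> ?X"
        by (intro nn_integral_mono mult_left_mono) (use * in \<open>auto simp: indicator_def A_def\<close>)
      then show ?thesis ..
    next
      assume *: "\<forall>z. fst z - s * snd z \<in> {a..a + 5 * ?d} \<longrightarrow>
         proj \<theta> (vector [snd z, fst z]) \<in> {q..q + 5 * ?d}"
      have "?I \<le> ?Y"
        by (intro nn_integral_mono mult_left_mono) (use * in \<open>auto simp: indicator_def A_def\<close>)
      then show ?thesis ..
    qed
    then show ?thesis by (auto intro: add_increasing add_increasing2)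
  qed
  with a have "?m \<le> ?X + ?Y" by (rule order_trans)
  then have "ennreal ((1/2) ^ k) * ?m \<le> ennreal ((1/2) ^ k) * (?X + ?Y)"
    by (rule mult_left_mono) simp
  also have "\<dots> \<le> emeasure (needle_measure J M) A"
    unfolding emeasure_needle_measure[OF A]
    using sum_le_suminf[OF summableI, of "{k}"] by fastforce
  also have "\<dots> = emeasure (proj_measure \<theta> (needle_measure J M)) {q..q + 5 * ?d}"
    using projm measurable_cong_sets[OF sets_needle_measure refl]
    by (subst proj_measure_def, subst emeasure_distr)
       (auto simp: A_def sets_eq_imp_space_eq[OF sets_needle_measure])
  finally show ?thesis by (auto simp flip: ennreal_mult)
qed

section \<open>Choice of parameters\<close>

text \<open>The exponent \<open>b\<close> solves \<open>2 * (t - 1) + b * (t - 1) = b\<close>, so the lower bound on \<open>M\<close> amounts to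
\<open>(J\<^sup>2 * M) powr (t - 1) \<le> M\<close>.\<close>

lemma needle_gap_le_width_powr:
  fixes t :: real
  assumes t: "1 \<le> t" "t < 2" and J: "J > 0" and M: "M > 0"
    and Mb: "real J powr ((2 * t - 2) / (2 - t)) \<le> real M"
  shows "1 / (4 * real M) \<le> needle_width J M powr (t - 1)"
proof -
  define b where "b = (2 * t - 2) / (2 - t)"
  have "(real J ^ 2 * real M) powr (t - 1) = real J powr (2 * (t - 1)) * real M powr (t - 1)"
    using J M by (simp add: powr_mult powr_powr flip: powr_numeral)
  also have "2 * (t - 1) = b * (2 - t)" using t by (simp add: b_def)
  also have "real J powr (b * (2 - t)) = (real J powr b) powr (2 - t)" by (simp add: powr_powr)
  also have "\<dots> \<le> real M powr (2 - t)" using Mb t by (intro powr_mono2) (auto simp: b_def)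
  also have "real M powr (2 - t) * real M powr (t - 1) = real M" using M by (simp flip: powr_add)
  finally have *: "(real J ^ 2 * real M) powr (t - 1) \<le> real M" by (simp add: mult_right_mono)
  have "1 / (4 * real M) \<le> 1 / real M" using M by (intro divide_left_mono) auto
  also have "\<dots> \<le> 1 / (real J ^ 2 * real M) powr (t - 1)"
    using * J M by (intro divide_left_mono) auto
  also have "\<dots> = needle_width J M powr (t - 1)"
    unfolding needle_width_def by (simp add: powr_divide)
  finally show ?thesis .
qed

text \<open>With \<open>M \<approx> J powr b\<close>, comparing the mass \<open>2 ^ (- k) / (4 * J * M)\<close> of a heavy tube with the bound
for its width \<open>5 / (J\<^sup>2 * M)\<close> gives \<open>J powr \<gamma> \<le> 40 * A * 2 ^ k\<close>, which the growth
\<open>J powr \<gamma> \<ge> 4 ^ k\<close> excludes for large \<open>k\<close>.\<close>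

lemma not_in_Lp_needle_measure:
  fixes t p \<gamma> :: real
  assumes p: "p > 1" and \<gamma>: "\<gamma> = (2 * (1 - 1 / p) - t) / (2 - t)" and t: "1 \<le> t" "t < 2"
    and J: "\<And>k. J k > 0" and M: "\<And>k. M k > 0"
    and Mb: "\<And>k. real (J k) powr ((2 * t - 2) / (2 - t)) \<le> real (M k)"
            "\<And>k. real (M k) \<le> 2 * real (J k) powr ((2 * t - 2) / (2 - t))"
    and big: "\<And>k. real (J k) powr \<gamma> \<ge> 4 ^ k" and \<theta>: "\<theta> \<in> sphere 0 1"
  shows "\<not> in_Lp p (proj_measure \<theta> (needle_measure J M))"
proof
  assume "in_Lp p (proj_measure \<theta> (needle_measure J M))"
  then obtain A where A: "A \<ge> 0" and Lp: "\<And>a L. L > 0 \<Longrightarrow>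
      emeasure (proj_measure \<theta> (needle_measure J M)) {a..a + L} \<le> ennreal (A * L powr (1 - 1 / p))"
    using in_Lp_interval_bound[OF _ p] by blast
  define b where "b = (2 * t - 2) / (2 - t)"
  define e where "e = 1 - 1 / p"
  have e: "0 < e" "e < 1" using p by (auto simp: e_def)
  have bound: "2 ^ k \<le> 40 * A" for k
  proof -
    let ?J = "real (J k)" and ?M = "real (M k)"
    let ?d = "needle_width (J k) (M k)"
    have J1: "?J \<ge> 1" using J[of k] by simp
    have d: "?d > 0" using J[of k] M[of k] by (simp add: needle_width_def)
    have "ennreal ((1/2) ^ k / (4 * ?J * ?M)) \<le> ennreal (A * (5 * ?d) powr e)"
      using needle_measure_heavy_interval[of J k M, OF J M \<theta>] Lp[of "5 * ?d"] d
      unfolding e_def by (meson order_trans mult_pos_pos zero_less_numeral)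
    then have "(1/2) ^ k / (4 * ?J * ?M) \<le> A * (5 * ?d) powr e"
      using A by (simp add: ennreal_le_iff)
    also have "(5 * ?d) powr e \<le> 5 * ?d powr e"
    proof -
      have "5 powr e \<le> (5::real) powr 1" using e by (intro powr_mono) auto
      then show ?thesis using d by (simp add: powr_mult mult_right_mono)
    qed
    also have "?d powr e \<le> ?J powr (- ((2 + b) * e))"
    proof -
      have "?J powr (2 + b) = ?J ^ 2 * ?J powr b" using J1 by (simp add: powr_add)
      also have "\<dots> \<le> ?J ^ 2 * ?M" using Mb(1)[of k] by (intro mult_left_mono) (auto simp: b_def)
      finally have "?d \<le> 1 / ?J powr (2 + b)"
        unfolding needle_width_def using J1 M[of k] by (intro divide_left_mono) auto
      also have "\<dots> = ?J powr (- (2 + b))" by (simp only: powr_minus_divide)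
      finally have "?d powr e \<le> (?J powr (- (2 + b))) powr e" using d e by (intro powr_mono2) auto
      then show ?thesis by (simp only: powr_powr mult_minus_left)
    qed
    finally have "(1/2) ^ k / (4 * ?J * ?M) \<le> A * (5 * ?J powr (- ((2 + b) * e)))"
      using A by (simp add: mult_left_mono)
    moreover have "(1/2) ^ k / (8 * ?J powr (1 + b)) \<le> (1/2) ^ k / (4 * ?J * ?M)"
    proof (intro divide_left_mono)
      have "4 * ?J * ?M \<le> 4 * ?J * (2 * ?J powr b)"
        using Mb(2)[of k] by (intro mult_left_mono) (auto simp: b_def)
      also have "\<dots> = 8 * ?J powr (1 + b)" using J1 by (simp add: powr_add)
      finally show "4 * ?J * ?M \<le> 8 * ?J powr (1 + b)" .
    qed (use J1 M[of k] in auto)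
    ultimately have "(1/2) ^ k / (8 * ?J powr (1 + b)) \<le> A * (5 * ?J powr (- ((2 + b) * e)))"
      by linarith
    then have "(1/2) ^ k \<le> 40 * A * (?J powr (- ((2 + b) * e)) * ?J powr (1 + b))"
      using J1 by (simp add: divide_le_eq algebra_simps)
    \<comment> \<open>The number \<open>\<gamma>\<close> is the gap between the exponents of mass and width bound.\<close>
    also have "?J powr (- ((2 + b) * e)) * ?J powr (1 + b) = ?J powr (- \<gamma>)"
    proof -
      have "2 + b = 2 / (2 - t)" "1 + b = t / (2 - t)"
        using t by (auto simp: b_def field_simps)
      then have "- ((2 + b) * e) + (1 + b) = - \<gamma>"
        unfolding \<gamma> e_def[symmetric] by (simp add: diff_divide_distrib)
      then show ?thesis by (simp flip: powr_add)
    qed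
    also have "?J powr (- \<gamma>) \<le> 1 / 4 ^ k"
      unfolding powr_minus_divide using big[of k] J1 by (intro divide_left_mono) auto
    finally have "(1/2) ^ k \<le> 40 * A * (1 / 4 ^ k)" using A by (simp add: mult_left_mono)
    then have "(1/2) ^ k * 4 ^ k \<le> 40 * A" by (simp add: field_simps)
    then show "2 ^ k \<le> 40 * A" by (simp flip: power_mult_distrib)
  qed
  obtain k where "40 * A < 2 ^ k" using real_arch_pow[of 2 "40 * A"] by auto
  with bound[of k] show False by simp
qed

theorem theorem1p1:
  fixes t p :: real
  assumes "1 \<le> t" and "t < 2" and "p > 2 / (2 - t)"
  shows "\<exists>\<mu> :: (real^2) measure.
           sets \<mu> = sets borel \<and> emeasure \<mu> (- cbox 0 1) = 0 \<and> frostman t \<mu> \<and>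
           (\<forall>\<theta>\<in>sphere 0 1. \<not> in_Lp p (proj_measure \<theta> \<mu>))"
proof -
  have "2 / (2 - t) \<ge> 2" using assms by (simp add: field_simps)
  then have p: "p > 1" using assms by linarith
  define \<gamma> where "\<gamma> = (2 * (1 - 1 / p) - t) / (2 - t)"
  have "2 < (2 - t) * p" using assms by (simp add: field_simps)
  \<comment> \<open>This is where the lower bound on \<open>p\<close> enters.\<close>
  then have \<gamma>: "\<gamma> > 0" using assms p unfolding \<gamma>_def by (intro divide_pos_pos) (auto simp: field_simps)
  have "\<exists>n::nat. n \<ge> 4 \<and> real n powr \<gamma> \<ge> 4 ^ k" for k :: nat
  proof -
    obtain n :: nat where n: "real n \<ge> (4 ^ k) powr (1 / \<gamma>)" using real_arch_simple by blast
    have "(4::real) ^ k = ((4 ^ k) powr (1 / \<gamma>)) powr \<gamma>" using \<gamma> by (simp add: powr_powr)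
    also have "\<dots> \<le> real (max n 4) powr \<gamma>" using n \<gamma> by (intro powr_mono2) auto
    finally show ?thesis by (intro exI[of _ "max n 4"]) simp
  qed
  then obtain J :: "nat \<Rightarrow> nat" where J: "\<And>k. J k \<ge> 4" "\<And>k. real (J k) powr \<gamma> \<ge> 4 ^ k"
    by metis
  have J0: "J k > 0" for k using J(1)[of k] by simp
  define b where "b = (2 * t - 2) / (2 - t)"
  define M where "M k = nat \<lceil>real (J k) powr b\<rceil>" for k
  have b0: "b \<ge> 0" using assms by (simp add: b_def)
  have J1: "real (J k) powr b \<ge> 1" for k using J0[of k] b0 by (intro ge_one_powr_ge_zero) auto
  have M: "M k > 0" "real (J k) powr b \<le> real (M k)" "real (M k) \<le> 2 * real (J k) powr b" for k
    using J1[of k] unfolding M_def by linarith+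
  have "\<not> in_Lp p (proj_measure \<theta> (needle_measure J M))" if "\<theta> \<in> sphere 0 1" for \<theta>
    using that not_in_Lp_needle_measure[OF p \<gamma>_def assms(1,2) J0 M(1) _ _ J(2)] M(2,3) by (simp add: b_def)
  moreover have "frostman t (needle_measure J M)"
    using M(2) by (intro frostman_needle_measure needle_gap_le_width_powr assms J J0 M(1))
      (simp add: b_def)
  ultimately show ?thesis
    using emeasure_needle_measure_outside[of J M] J(1) by (intro exI[of _ "needle_measure J M"]) auto
qed

end
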